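(* Let $A$ be a commutative group (written multiplicatively). For $q\geq 0$ let $K_q=A^{\frac{q(q-1)}{2}}$, whose elements are written as families $(a_{u,v})_{0\leq u<v\leq q-1}$, with componentwise multiplication. For $q\ge 1$ and $0\leq i\leq q$ define $\partial_i:K_q\to K_{q-1}$ by $\partial_i((a_{u,v})_{0\leq u<v\leq q-1})=(b_{u,v})_{0\leq u<v\leq q-2}$, where $$b_{u,v}=\begin{cases} a_{u,v} & \text{if } 0\leq u<v<i-1,\\ a_{u,v}\,a_{u,i}\,a_{v,i}^{-1} & \text{if } 0\leq u<v=i-1,\\ a_{u,v+1} & \text{if } 0\leq u\leq i-1<v,\\ a_{u+1,v+1} & \text{if } i-1<u<v,\end{cases}$$ and for $q\ge0$ and $0\leq i\leq q$ define $s_i:K_q\to K_{q+1}$ by $s_i((a_{u,v})_{0\leq u<v\leq q-1})=(c_{u,v})_{0\leq u<v\leq q}$, where $$c_{u,v}=\begin{cases} a_{u,v} & \text{if } 0\leq u<v<i,\\ 1 & \text{if } 0\leq u<v=i,\\ a_{u,v-1} & \text{if } 0\leq u<i<v,\\ a_{u,v-1} & \text{if } 0\leq u=i<v-1,\\ 1 & \text{if } 0\leq u=i=v-1,\\ a_{u-1,v-1} & \text{if } 0\leq i<u<v.\end{cases}$$ Then $(K_q,\partial_i,s_i)$ is a $K(A,2)$ simplicial group, i.e. it is a simplicial group whose homotopy groups satisfy $\pi_2\cong A$ and $\pi_m$ trivial for all $m\neq 2$.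
   Context: A simplicial group consists of groups $X_q$, $q\geq 0$, with group morphisms $\partial_i:X_q\to X_{q-1}$ ($q\ge1$) and $s_i:X_q\to X_{q+1}$ for $0\leq i\leq q$, satisfying: $\partial_i\partial_j=\partial_{j-1}\partial_i$ if $i<j$; $s_is_j=s_{j+1}s_i$ if $i\leq j$; $\partial_is_j=s_{j-1}\partial_i$ if $i<j$; $\partial_js_j=\partial_{j+1}s_j=\mathrm{id}$; $\partial_is_j=s_j\partial_{i-1}$ if $i>j+1$. For a simplicial group $\mathbf{K}=(K_q,\partial_i,s_i)$ put $\overline{K}_q=K_q\cap \mathrm{Ker}(\partial_0)\cap\dots\cap \mathrm{Ker}(\partial_{q-1})$ (so $\overline{K}_0=K_0$). With differential $\partial_q:\overline{K}_q\to\overline{K}_{q-1}$ this is a chain complex, and the homotopy groups are $\pi_q(\mathbf{K})=H_q(\overline{\mathbf{K}})$. A $K(G,n)$ simplicial group (Eilenberg-MacLane simplicial group) is a simplicial group with $\pi_n\cong G$ and $\pi_m$ trivial for $m\neq n$. *)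

theory Defs
  imports "HOL-Algebra.Product_Groups"
begin

text \<open>
  A simplicial group with groups \<open>X q\<close>, face maps \<open>d q i : X q \<rightarrow> X (q - 1)\<close> (meaningful for
  \<open>1 \<le> q\<close>, \<open>i \<le> q\<close>) and degeneracy maps \<open>s q i : X q \<rightarrow> X (q + 1)\<close> (meaningful for \<open>i \<le> q\<close>).
  The values of \<open>d\<close> and \<open>s\<close> at other indices, or outside the carriers, are irrelevant.
\<close>

locale simplicial_group =
  fixes X :: "nat \<Rightarrow> ('a, 'b) monoid_scheme"
    and d :: "nat \<Rightarrow> nat \<Rightarrow> 'a \<Rightarrow> 'a"
    and s :: "nat \<Rightarrow> nat \<Rightarrow> 'a \<Rightarrow> 'a"
  assumes group_X: "group (X q)"
    and face_hom: "1 \<le> q \<Longrightarrow> i \<le> q \<Longrightarrow> d q i \<in> hom (X q) (X (q - 1))"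
    and degen_hom: "i \<le> q \<Longrightarrow> s q i \<in> hom (X q) (X (q + 1))"
    and face_face: "2 \<le> q \<Longrightarrow> i < j \<Longrightarrow> j \<le> q \<Longrightarrow> x \<in> carrier (X q) \<Longrightarrow>
          d (q - 1) i (d q j x) = d (q - 1) (j - 1) (d q i x)"
    and degen_degen: "i \<le> j \<Longrightarrow> j \<le> q \<Longrightarrow> x \<in> carrier (X q) \<Longrightarrow>
          s (q + 1) i (s q j x) = s (q + 1) (j + 1) (s q i x)"
    and face_degen_less: "i < j \<Longrightarrow> j \<le> q \<Longrightarrow> x \<in> carrier (X q) \<Longrightarrow>
          d (q + 1) i (s q j x) = s (q - 1) (j - 1) (d q i x)"
    and face_degen_same: "j \<le> q \<Longrightarrow> x \<in> carrier (X q) \<Longrightarrow> d (q + 1) j (s q j x) = x"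
    and face_degen_Suc: "j \<le> q \<Longrightarrow> x \<in> carrier (X q) \<Longrightarrow> d (q + 1) (j + 1) (s q j x) = x"
    and face_degen_greater: "j + 1 < i \<Longrightarrow> i \<le> q + 1 \<Longrightarrow> x \<in> carrier (X q) \<Longrightarrow>
          d (q + 1) i (s q j x) = s (q - 1) j (d q (i - 1) x)"

text \<open>The normalized (Moore) chain complex; for \<open>q = 0\<close> the intersection over \<open>i < 0\<close> is everything.\<close>

definition moore_carrier ::
  "(nat \<Rightarrow> ('a, 'b) monoid_scheme) \<Rightarrow> (nat \<Rightarrow> nat \<Rightarrow> 'a \<Rightarrow> 'a) \<Rightarrow> nat \<Rightarrow> 'a set" where
  "moore_carrier X d q = carrier (X q) \<inter> (\<Inter>i<q. kernel (X q) (X (q - 1)) (d q i))"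

text \<open>The differential out of degree \<open>0\<close> is trivial, so every element of degree \<open>0\<close> is a cycle.\<close>

definition moore_cycles ::
  "(nat \<Rightarrow> ('a, 'b) monoid_scheme) \<Rightarrow> (nat \<Rightarrow> nat \<Rightarrow> 'a \<Rightarrow> 'a) \<Rightarrow> nat \<Rightarrow> 'a set" where
  "moore_cycles X d q =
     (if q = 0 then moore_carrier X d 0
      else moore_carrier X d q \<inter> kernel (X q) (X (q - 1)) (d q q))"

definition moore_boundaries ::
  "(nat \<Rightarrow> ('a, 'b) monoid_scheme) \<Rightarrow> (nat \<Rightarrow> nat \<Rightarrow> 'a \<Rightarrow> 'a) \<Rightarrow> nat \<Rightarrow> 'a set" where
  "moore_boundaries X d q = d (q + 1) (q + 1) ` moore_carrier X d (q + 1)"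

definition homotopy_group ::
  "(nat \<Rightarrow> ('a, 'b) monoid_scheme) \<Rightarrow> (nat \<Rightarrow> nat \<Rightarrow> 'a \<Rightarrow> 'a) \<Rightarrow> nat \<Rightarrow> 'a set monoid" where
  "homotopy_group X d q =
     ((X q)\<lparr>carrier := moore_cycles X d q\<rparr>) Mod moore_boundaries X d q"

definition eilenberg_maclane ::
  "('g, 'h) monoid_scheme \<Rightarrow> nat \<Rightarrow> (nat \<Rightarrow> ('a, 'b) monoid_scheme) \<Rightarrow>
     (nat \<Rightarrow> nat \<Rightarrow> 'a \<Rightarrow> 'a) \<Rightarrow> (nat \<Rightarrow> nat \<Rightarrow> 'a \<Rightarrow> 'a) \<Rightarrow> bool" where
  "eilenberg_maclane G n X d s \<longleftrightarrow>
     simplicial_group X d s \<and> homotopy_group X d n \<cong> G \<and>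
     (\<forall>m. m \<noteq> n \<longrightarrow> trivial_group (homotopy_group X d m))"

text \<open>
  The index set \<open>0 \<le> u < v \<le> q - 1\<close> (empty for \<open>q = 0\<close>). Families over it are functions on pairs
  that are \<open>undefined\<close> off the index set, as in the carrier of \<^const>\<open>product_group\<close>.
\<close>

definition pair_index :: "nat \<Rightarrow> (nat \<times> nat) set" where
  "pair_index q = {(u, v). u < v \<and> v < q}"

definition K_group :: "('a, 'b) monoid_scheme \<Rightarrow> nat \<Rightarrow> (nat \<times> nat \<Rightarrow> 'a) monoid" where
  "K_group A q = product_group (pair_index q) (\<lambda>_. A)"

text \<open>
  Since subtraction on \<^typ>\<open>nat\<close> is truncated, \<open>v < i - 1\<close>, \<open>v = i - 1\<close>, \<open>u \<le> i - 1 < v\<close> and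
  \<open>i - 1 < u\<close> (read in the integers, where \<open>i = 0\<close> is allowed) are written \<open>v + 1 < i\<close>,
  \<open>v + 1 = i\<close>, \<open>u < i \<and> i \<le> v\<close> and \<open>i \<le> u\<close>. As \<open>u < v\<close>, these cases are exclusive and the last
  one is what remains.
\<close>

definition K_face ::
  "('a, 'b) monoid_scheme \<Rightarrow> nat \<Rightarrow> nat \<Rightarrow> (nat \<times> nat \<Rightarrow> 'a) \<Rightarrow> nat \<times> nat \<Rightarrow> 'a" where
  "K_face A q i a = (\<lambda>(u, v)\<in>pair_index (q - 1).
     if v + 1 < i then a (u, v)
     else if v + 1 = i then a (u, v) \<otimes>\<^bsub>A\<^esub> a (u, i) \<otimes>\<^bsub>A\<^esub> inv\<^bsub>A\<^esub> a (v, i)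
     else if u < i \<and> i \<le> v then a (u, v + 1)
     else a (u + 1, v + 1))"

text \<open>Likewise, the last case below is \<open>i < u\<close>.\<close>

definition K_degen ::
  "('a, 'b) monoid_scheme \<Rightarrow> nat \<Rightarrow> nat \<Rightarrow> (nat \<times> nat \<Rightarrow> 'a) \<Rightarrow> nat \<times> nat \<Rightarrow> 'a" where
  "K_degen A q i a = (\<lambda>(u, v)\<in>pair_index (q + 1).
     if v < i then a (u, v)
     else if v = i then \<one>\<^bsub>A\<^esub>
     else if u < i \<and> i < v then a (u, v - 1)
     else if u = i \<and> i + 1 < v then a (u, v - 1)
     else if u = i \<and> v = i + 1 then \<one>\<^bsub>A\<^esub>
     else a (u - 1, v - 1))"

end

theory Submission
  imports Defs
begin

text \<open>
  The family \<open>(a u v)\<close> in \<open>K q\<close> records the values \<open>f (u, v, v + 1)\<close> of a normalized \<open>2\<close>-cocycle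
  on the \<open>q\<close>-simplex. Faces and degeneracies are the pullbacks of cocycles along the simplicial
  maps; only when a face removes the vertex \<open>v + 1\<close> is the cocycle relation
  \<open>f (u, v, v + 2) = f (u, v, v + 1) f (u, v + 1, v + 2) f (v, v + 1, v + 2)\<^sup>-\<^sup>1\<close> needed to express
  the result. A Moore chain of degree \<open>q \<noteq> 2\<close> is trivial: face \<open>0\<close> kills the entries with
  \<open>u > 0\<close>, face \<open>1\<close> those with \<open>u = 0\<close>, \<open>v > 1\<close>, and face \<open>2\<close>, which is a constraint as soon
  as \<open>q \<ge> 3\<close>, the entry \<open>(0, 1)\<close>. In degree \<open>2\<close> the faces take values in the trivial group
  \<open>K 1\<close>, so the Moore complex is \<open>A\<close> concentrated in degree \<open>2\<close>.
\<close>

section \<open>Entrywise description of the groups and operators\<close>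

lemma K_groupD: "a \<in> carrier (K_group A q) \<Longrightarrow> u < v \<Longrightarrow> v < q \<Longrightarrow> a (u, v) \<in> carrier A"
  by (auto simp: K_group_def pair_index_def)

text \<open>Families are \<open>undefined\<close> off \<open>pair_index q\<close>, so nothing else
  has to be compared. All identities below are reduced to entries this way.\<close>

lemma K_group_eqI:
  assumes "a \<in> carrier (K_group A q)" "b \<in> carrier (K_group A q)"
    and "\<And>u v. u < v \<Longrightarrow> v < q \<Longrightarrow> a (u, v) = b (u, v)"
  shows "a = b"
proof -
  have "a p = b p" if "p \<in> pair_index q" for p
    using that assms(3) by (cases p) (simp add: pair_index_def)
  with assms(1,2) show ?thesis
    unfolding K_group_def carrier_product_group by (rule PiE_ext)
qed

lemma K_face_apply: "u < v \<Longrightarrow> v + 1 < q \<Longrightarrow> K_face A q i a (u, v) =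
    (if v + 1 < i then a (u, v)
     else if v + 1 = i then a (u, v) \<otimes>\<^bsub>A\<^esub> a (u, i) \<otimes>\<^bsub>A\<^esub> inv\<^bsub>A\<^esub> a (v, i)
     else if u < i then a (u, v + 1)
     else a (u + 1, v + 1))"
  by (auto simp: K_face_def pair_index_def)

text \<open>Testing the pair \<open>(i, i + 1)\<close> early lets two cases of the definition merge
  into \<open>u \<le> i\<close>. The value \<open>\<one>\<close> marks the triangles that acquire a
  repeated vertex when \<open>i\<close> and \<open>i + 1\<close> are identified.\<close>

lemma K_degen_apply: "u < v \<Longrightarrow> v < q + 1 \<Longrightarrow> K_degen A q i a (u, v) =
    (if v < i then a (u, v)
     else if v = i then \<one>\<^bsub>A\<^esub>
     else if u = i \<and> v = i + 1 then \<one>\<^bsub>A\<^esub>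
     else if u \<le> i then a (u, v - 1)
     else a (u - 1, v - 1))"
  by (auto simp: K_degen_def pair_index_def)

section \<open>Simplicial identities\<close>

context comm_group begin

text \<open>The target degree is a variable \<open>r\<close> so that the rule also matches goals
  stated with \<open>q\<close> in place of \<open>q + 1 - 1\<close>; the equation becomes an
  arithmetic side goal.\<close>

lemma K_face_closed:
  assumes "a \<in> carrier (K_group G q)" "i \<le> q" "r = q - 1"
  shows "K_face G q i a \<in> carrier (K_group G r)"
  using assms by (auto simp: K_group_def K_face_def pair_index_def PiE_iff)

lemma K_degen_closed:
  assumes "a \<in> carrier (K_group G q)" "i \<le> q" "r = q + 1"
  shows "K_degen G q i a \<in> carrier (K_group G r)"
proof -
  have "K_degen G q i a (u, v) \<in> carrier G" if uv: "u < v" "v < q + 1" for u v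
  proof (cases "v = i \<or> u = i \<and> v = i + 1")
    case False
    \<comment> \<open>Each bound says that the entry being read has strictly increasing
      indices.\<close>
    then consider "v < i" | "u \<le> i" "u < v - 1" "\<not> v < i" | "i < u" "u - 1 < v - 1"
      using uv by linarith
    then show ?thesis
      using False uv K_groupD[OF assms(1)] assms(2) by cases (simp_all add: K_degen_apply)
  qed (use uv in \<open>auto simp: K_degen_apply\<close>)
  then show ?thesis
    using assms(3) by (auto simp: K_group_def pair_index_def PiE_iff K_degen_def)
qed

lemma K_degen_degen:
  assumes "i \<le> j" "j \<le> q" "a \<in> carrier (K_group G q)"
  shows "K_degen G (q + 1) i (K_degen G q j a) = K_degen G (q + 1) (j + 1) (K_degen G q i a)"
proof (rule K_group_eqI[where A = G and q = "q + 2"])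
  fix u v assume uv: "u < v" "v < q + 2"
  then obtain w where w: "v = Suc w" "u \<le> w" by (cases v) auto
  note facts = uv assms(1,2) w
  \<comment> \<open>These are the cases of the outer operator on the left. The predecessors
    \<open>w\<close> and \<open>t\<close> replace truncated subtraction; only their position
    relative to \<open>j\<close> remains to be compared.\<close>
  consider "v < i" | "v = i" | "i < v" "u < i" | "u = i" "v = i + 1" | "u = i" "i < w"
    | t where "u = Suc t" "i \<le> t" "t < w"
    using uv w
    by (cases u; cases rule: linorder_cases[of v i]; cases rule: linorder_cases[of u i];
        cases rule: linorder_cases[of w i]) auto
  then show "K_degen G (q + 1) i (K_degen G q j a) (u, v)
    = K_degen G (q + 1) (j + 1) (K_degen G q i a) (u, v)"
  proof cases
    case 1
    then show ?thesis using facts by (simp add: K_degen_apply)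
  next
    case 2
    then show ?thesis using facts by (simp add: K_degen_apply)
  next
    case 3
    then show ?thesis using facts
      by (cases rule: linorder_cases[of w j]) (simp_all add: K_degen_apply)
  next
    case 4
    then show ?thesis using facts
      by (cases rule: linorder_cases[of i j]) (simp_all add: K_degen_apply)
  next
    case 5
    then show ?thesis using facts
      by (cases rule: linorder_cases[of w j]) (simp_all add: K_degen_apply)
  next
    case 6
    then show ?thesis using facts
      by (cases rule: linorder_cases[of w j]; cases rule: linorder_cases[of t j])
        (simp_all add: K_degen_apply)
  qed
qed (rule K_degen_closed assms | use assms in simp)+

lemma K_face_degen_less:
  assumes "i < j" "j \<le> q" "a \<in> carrier (K_group G q)"
  shows "K_face G (q + 1) i (K_degen G q j a) = K_degen G (q - 1) (j - 1) (K_face G q i a)"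
proof (rule K_group_eqI[where A = G and q = q])
  fix u v assume uv: "u < v" "v < q"
  then obtain w where w: "v = Suc w" "u \<le> w" by (cases v) auto
  obtain k where k: "j = Suc k" "i \<le> k" using assms(1) by (cases j) auto
  note facts = uv assms(2) w k
  consider "v + 1 < i" | "v + 1 = i" | "u < i" "i \<le> v" | "i \<le> u"
    by linarith
  then show "K_face G (q + 1) i (K_degen G q j a) (u, v)
    = K_degen G (q - 1) (j - 1) (K_face G q i a) (u, v)"
  proof cases
    case 1
    then show ?thesis using facts by (simp add: K_degen_apply K_face_apply)
  next
    \<comment> \<open>The product reads entries with second index at most \<open>i < j\<close>,
      which the degeneracy leaves unchanged.\<close>
    case 2
    then show ?thesis using facts by (simp add: K_degen_apply K_face_apply)
  next
    case 3
    then show ?thesis using facts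
      by (cases rule: linorder_cases[of v k]) (simp_all add: K_degen_apply K_face_apply)
  next
    case 4
    then show ?thesis using facts
      by (cases u; cases rule: linorder_cases[of u k]; cases rule: linorder_cases[of w k];
          cases rule: linorder_cases[of v k])
        (simp_all add: K_degen_apply K_face_apply)
  qed
qed (rule K_degen_closed K_face_closed assms | use assms in simp)+

text \<open>In the product case \<open>v + 1 = j\<close> the factors at \<open>(u, j)\<close> and
  \<open>(v, j)\<close> are \<open>\<one>\<close>.\<close>

lemma K_face_degen_same:
  assumes "j \<le> q" "a \<in> carrier (K_group G q)"
  shows "K_face G (q + 1) j (K_degen G q j a) = a"
proof (rule K_group_eqI[where A = G and q = q])
  fix u v assume uv: "u < v" "v < q"
  then show "K_face G (q + 1) j (K_degen G q j a) (u, v) = a (u, v)"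
    using assms(1) K_groupD[OF assms(2) uv]
    by (cases rule: linorder_cases[of "v + 1" j]; cases rule: linorder_cases[of u j])
      (simp_all add: K_degen_apply K_face_apply)
qed (rule K_degen_closed K_face_closed assms | use assms in simp)+

text \<open>In the product case \<open>v = j\<close> the factors at \<open>(u, j)\<close> and
  \<open>(j, j + 1)\<close> are \<open>\<one>\<close>, and the middle factor at
  \<open>(u, j + 1)\<close> is \<open>a (u, j)\<close>.\<close>

lemma K_face_degen_Suc:
  assumes "j \<le> q" "a \<in> carrier (K_group G q)"
  shows "K_face G (q + 1) (j + 1) (K_degen G q j a) = a"
proof (rule K_group_eqI[where A = G and q = q])
  fix u v assume uv: "u < v" "v < q"
  then show "K_face G (q + 1) (j + 1) (K_degen G q j a) (u, v) = a (u, v)"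
    using assms(1) K_groupD[OF assms(2) uv]
    by (cases rule: linorder_cases[of v j]; cases rule: linorder_cases[of u j])
      (simp_all add: K_degen_apply K_face_apply)
qed (rule K_degen_closed K_face_closed assms | use assms in simp)+

lemma K_face_degen_greater:
  assumes "j + 1 < i" "i \<le> q + 1" "a \<in> carrier (K_group G q)"
  shows "K_face G (q + 1) i (K_degen G q j a) = K_degen G (q - 1) j (K_face G q (i - 1) a)"
proof (rule K_group_eqI[where A = G and q = q])
  fix u v assume uv: "u < v" "v < q"
  then obtain w where w: "v = Suc w" "u \<le> w" by (cases v) auto
  obtain k where k: "i = Suc (Suc k)" "j \<le> k" using assms(1) that[of "i - 2"] by linarith
  note facts = uv assms(2) w k
  note [simp] = K_groupD[OF assms(3)]
  consider "v < j" | "v = j" | "j < v" "u < j" | "u = j" "v = j + 1" | "u = j" "j < w"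
    | t where "u = Suc t" "j \<le> t" "t < w"
    using uv w
    by (cases u; cases rule: linorder_cases[of v j]; cases rule: linorder_cases[of u j];
        cases rule: linorder_cases[of w j]) auto
  then show "K_face G (q + 1) i (K_degen G q j a) (u, v)
    = K_degen G (q - 1) j (K_face G q (i - 1) a) (u, v)"
  proof cases
    case 1
    then show ?thesis using facts by (simp add: K_degen_apply K_face_apply)
  next
    case 2
    then show ?thesis using facts by (simp add: K_degen_apply K_face_apply)
  next
    case 3
    then show ?thesis using facts
      by (cases rule: linorder_cases[of w k]) (simp_all add: K_degen_apply K_face_apply)
  next
    \<comment> \<open>For \<open>j = k\<close> the face is in its product case: its last two factors
      both come from \<open>a (j, j + 1)\<close> and cancel.\<close>
    case 4
    then show ?thesis using facts
      by (cases rule: linorder_cases[of j k]) (simp_all add: K_degen_apply K_face_apply)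
  next
    case 5
    then show ?thesis using facts
      by (cases rule: linorder_cases[of w k]) (simp_all add: K_degen_apply K_face_apply)
  next
    case 6
    then show ?thesis using facts
      by (cases rule: linorder_cases[of w k]; cases rule: linorder_cases[of t k])
        (simp_all add: K_degen_apply K_face_apply)
  qed
qed (rule K_degen_closed K_face_closed assms | use assms in simp)+

text \<open>The algebra behind composing two product cases in \<open>K_face_face\<close>: the common
  factor \<open>z\<close> occurs once with each sign.\<close>

lemma mult_inv_mult_cancel:
  assumes "p \<in> carrier G" "x \<in> carrier G" "y \<in> carrier G" "x' \<in> carrier G" "y' \<in> carrier G"
    "z \<in> carrier G"
  shows "p \<otimes> (x \<otimes> y \<otimes> inv z) \<otimes> inv (x' \<otimes> y' \<otimes> inv z) = p \<otimes> x \<otimes> inv x' \<otimes> y \<otimes> inv y'"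
proof -
  have "p \<otimes> (x \<otimes> y \<otimes> inv z) \<otimes> inv (x' \<otimes> y' \<otimes> inv z)
    = p \<otimes> (x \<otimes> y \<otimes> inv z) \<otimes> (inv x' \<otimes> inv y' \<otimes> z)"
    using assms by (simp add: inv_mult)
  also have "\<dots> = p \<otimes> x \<otimes> inv x' \<otimes> y \<otimes> inv y' \<otimes> (inv z \<otimes> z)"
    by (simp only: m_ac m_closed inv_closed assms)
  finally show ?thesis using assms by simp
qed

lemma K_face_face:
  assumes "i < j" "j \<le> q" "a \<in> carrier (K_group G q)"
  shows "K_face G (q - 1) i (K_face G q j a) = K_face G (q - 1) (j - 1) (K_face G q i a)"
proof (rule K_group_eqI[where A = G and q = "q - 2"])
  fix u v assume uv: "u < v" "v < q - 2"
  obtain k where k: "j = Suc k" "i \<le> k" using assms(1) by (cases j) auto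
  note facts = uv assms(2) k
  note [simp] = K_groupD[OF assms(3)]
  consider "v + 1 < i" | "v + 1 = i" "i < k" | "v + 1 = i" "i = k" | "u < i" "i \<le> v" | "i \<le> u"
    using k by linarith
  then show "K_face G (q - 1) i (K_face G q j a) (u, v)
    = K_face G (q - 1) (j - 1) (K_face G q i a) (u, v)"
  proof cases
    case 1
    then show ?thesis using facts by (simp add: K_face_apply)
  next
    case 2
    then show ?thesis using facts by (simp add: K_face_apply)
  next
    \<comment> \<open>Here the adjacent vertices \<open>v + 1\<close> and \<open>v + 2\<close> are
      removed, and both sides expand \<open>f (u, v, v + 3)\<close> by the cocycle relation. The
      cancelled factor is \<open>a (i, j)\<close>, that is
      \<open>f (v + 1, v + 2, v + 3)\<close>.\<close>
    case 3
    then show ?thesis using facts by (simp add: K_face_apply mult_inv_mult_cancel)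
  next
    case 4
    then show ?thesis using facts
      by (cases rule: linorder_cases[of "v + 1" k]) (simp_all add: K_face_apply)
  next
    case 5
    then show ?thesis using facts
      by (cases rule: linorder_cases[of "v + 1" k]; cases rule: linorder_cases[of u k])
        (simp_all add: K_face_apply)
  qed
qed (rule K_face_closed assms | use assms in simp)+

section \<open>Group structure and homomorphisms\<close>

lemma group_K_group: "group (K_group G q)"
  by (simp add: K_group_def)

lemma K_group_mult_apply:
  "u < v \<Longrightarrow> v < q \<Longrightarrow> (a \<otimes>\<^bsub>K_group G q\<^esub> b) (u, v) = a (u, v) \<otimes> b (u, v)"
  by (simp add: K_group_def pair_index_def)

lemma K_group_one_apply: "u < v \<Longrightarrow> v < q \<Longrightarrow> \<one>\<^bsub>K_group G q\<^esub> (u, v) = \<one>"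
  by (simp add: K_group_def pair_index_def)

lemma K_group_mult_closed:
  "a \<in> carrier (K_group G q) \<Longrightarrow> b \<in> carrier (K_group G q) \<Longrightarrow>
    a \<otimes>\<^bsub>K_group G q\<^esub> b \<in> carrier (K_group G q)"
  by (rule monoid.m_closed[OF group.is_monoid[OF group_K_group]])

lemma K_group_one_closed: "\<one>\<^bsub>K_group G q\<^esub> \<in> carrier (K_group G q)"
  using group_K_group by (simp add: group.is_monoid)

text \<open>Commutativity enters in the product case, to regroup the factors and distribute the
  inverse.\<close>

lemma K_face_hom:
  assumes "1 \<le> q" "i \<le> q"
  shows "K_face G q i \<in> hom (K_group G q) (K_group G (q - 1))"
proof (rule homI)
  fix a b assume a: "a \<in> carrier (K_group G q)" and b: "b \<in> carrier (K_group G q)"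
  note [simp] = K_groupD[OF a] K_groupD[OF b]
  show "K_face G q i (a \<otimes>\<^bsub>K_group G q\<^esub> b)
    = K_face G q i a \<otimes>\<^bsub>K_group G (q - 1)\<^esub> K_face G q i b"
  proof (rule K_group_eqI[where A = G and q = "q - 1"])
    fix u v assume "u < v" "v < q - 1"
    then show "K_face G q i (a \<otimes>\<^bsub>K_group G q\<^esub> b) (u, v)
      = (K_face G q i a \<otimes>\<^bsub>K_group G (q - 1)\<^esub> K_face G q i b) (u, v)"
      using assms by (auto simp: K_face_apply K_group_mult_apply inv_mult m_ac)
  qed (rule K_face_closed K_group_mult_closed assms a b | use assms in simp)+
next
  fix a assume "a \<in> carrier (K_group G q)"
  then show "K_face G q i a \<in> carrier (K_group G (q - 1))"
    using assms(2) by (rule K_face_closed) simp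
qed

lemma K_degen_hom:
  assumes "i \<le> q"
  shows "K_degen G q i \<in> hom (K_group G q) (K_group G (q + 1))"
proof (rule homI)
  fix a b assume a: "a \<in> carrier (K_group G q)" and b: "b \<in> carrier (K_group G q)"
  show "K_degen G q i (a \<otimes>\<^bsub>K_group G q\<^esub> b)
    = K_degen G q i a \<otimes>\<^bsub>K_group G (q + 1)\<^esub> K_degen G q i b"
  proof (rule K_group_eqI[where A = G and q = "q + 1"])
    fix u v assume uv: "u < v" "v < q + 1"
    consider "v < i" | "v = i \<or> u = i \<and> v = i + 1" | "u \<le> i" "u < v - 1" "i < v"
      | "i < u" "u - 1 < v - 1"
      using uv by linarith
    then show "K_degen G q i (a \<otimes>\<^bsub>K_group G q\<^esub> b) (u, v)
      = (K_degen G q i a \<otimes>\<^bsub>K_group G (q + 1)\<^esub> K_degen G q i b) (u, v)"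
      using uv assms by cases (auto simp: K_degen_apply K_group_mult_apply)
  qed (rule K_degen_closed K_group_mult_closed assms a b | use assms in simp)+
next
  fix a assume "a \<in> carrier (K_group G q)"
  then show "K_degen G q i a \<in> carrier (K_group G (q + 1))"
    using assms by (rule K_degen_closed) simp
qed

lemma simplicial_group_K: "simplicial_group (K_group G) (K_face G) (K_degen G)"
  by (rule simplicial_group.intro)
    (rule group_K_group K_face_hom K_degen_hom K_face_face K_degen_degen K_face_degen_less
      K_face_degen_same K_face_degen_Suc K_face_degen_greater; assumption)+

section \<open>The Moore complex\<close>

lemma carrier_K_group_less_2:
  assumes "q < 2"
  shows "carrier (K_group G q) = {\<one>\<^bsub>K_group G q\<^esub>}"
proof -
  have "a = \<one>\<^bsub>K_group G q\<^esub>" if "a \<in> carrier (K_group G q)" for a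
    using that K_group_one_closed by (rule K_group_eqI) (use assms in linarith)
  then show ?thesis using K_group_one_closed by blast
qed

lemma K_face_one:
  "1 \<le> q \<Longrightarrow> i \<le> q \<Longrightarrow> K_face G q i \<one>\<^bsub>K_group G q\<^esub> = \<one>\<^bsub>K_group G (q - 1)\<^esub>"
  by (intro hom_one[OF K_face_hom] group_K_group)

lemma one_in_moore_carrier: "\<one>\<^bsub>K_group G q\<^esub> \<in> moore_carrier (K_group G) (K_face G) q"
  by (simp add: moore_carrier_def kernel_def K_group_one_closed K_face_one)

lemma moore_carrier_K:
  assumes "q \<noteq> 2"
  shows "moore_carrier (K_group G) (K_face G) q = {\<one>\<^bsub>K_group G q\<^esub>}"
proof -
  have "a = \<one>\<^bsub>K_group G q\<^esub>" if "a \<in> moore_carrier (K_group G) (K_face G) q" for a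
  proof -
    from that have a: "a \<in> carrier (K_group G q)"
      and "\<And>i. i < q \<Longrightarrow> K_face G q i a = \<one>\<^bsub>K_group G (q - 1)\<^esub>"
      by (auto simp: moore_carrier_def kernel_def)
    then have face: "K_face G q i a (u, v) = \<one>" if "i < q" "u < v" "v < q - 1" for i u v
      using that by (simp add: K_group_one_apply)
    have pos: "a (u, v) = \<one>" if "0 < u" "u < v" "v < q" for u v
      using that face[of 0 "u - 1" "v - 1"] by (simp add: K_face_apply)
    have ge2: "a (0, v) = \<one>" if "2 \<le> v" "v < q" for v
      using that face[of 1 0 "v - 1"] by (simp add: K_face_apply)
    \<comment> \<open>Face \<open>2\<close> at \<open>(0, 1)\<close> is
      \<open>a (0, 1) \<otimes> a (0, 2) \<otimes> inv a (1, 2)\<close>, whose last two factors are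
      already known to be trivial. Excluding \<open>q = 2\<close> gives \<open>q \<ge> 3\<close>, so
      that this face is among the vanishing ones.\<close>
    have "a (0, 1) = \<one>" if "1 < q"
      using that assms face[of 2 0 1] pos[of 1 2] ge2[of 2] K_groupD[OF a, of 0 1]
      by (simp add: K_face_apply)
    then have "a (u, v) = \<one>" if "u < v" "v < q" for u v
      using that pos[of u v] ge2[of v] by (cases "u = 0"; cases "v = 1") auto
    then show ?thesis
      by (intro K_group_eqI[OF a K_group_one_closed]) (simp add: K_group_one_apply)
  qed
  then show ?thesis using one_in_moore_carrier by blast
qed

text \<open>In degree \<open>2\<close> every face lands in the one-element group of degree
  \<open>1\<close>, so every element is a cycle.\<close>

lemma moore_cycles_K:
  "moore_cycles (K_group G) (K_face G) q
    = (if q = 2 then carrier (K_group G 2) else {\<one>\<^bsub>K_group G q\<^esub>})"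
proof (cases "q = 2")
  case True
  have "K_face G 2 i a = \<one>\<^bsub>K_group G (Suc 0)\<^esub>" if "i \<le> 2" "a \<in> carrier (K_group G 2)" for i a
    using K_face_closed[OF that(2,1), of 1] carrier_K_group_less_2[of 1] by simp
  with True show ?thesis
    by (auto simp: moore_cycles_def moore_carrier_def kernel_def)
next
  case False
  then show ?thesis
    using K_group_one_closed K_face_one
    by (auto simp: moore_cycles_def moore_carrier_K kernel_def)
qed

lemma moore_boundaries_K: "moore_boundaries (K_group G) (K_face G) q = {\<one>\<^bsub>K_group G q\<^esub>}"
proof -
  let ?M = "moore_carrier (K_group G) (K_face G) (q + 1)"
  have "K_face G (q + 1) (q + 1) ` ?M \<subseteq> {\<one>\<^bsub>K_group G q\<^esub>}"
  \<comment> \<open>Only for \<open>q = 1\<close> can the chains of degree \<open>q + 1\<close> be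
    nontrivial, and then the target is a one-element group.\<close>
  proof (cases "q = 1")
    case True
    have "K_face G 2 2 a \<in> carrier (K_group G 1)" if "a \<in> carrier (K_group G 2)" for a
      using that by (rule K_face_closed) simp_all
    with True show ?thesis
      by (auto simp: moore_carrier_def carrier_K_group_less_2 numeral_2_eq_2)
  next
    case False
    then show ?thesis
      using K_face_one[of "q + 1" "q + 1"] by (simp add: moore_carrier_K)
  qed
  moreover have "\<one>\<^bsub>K_group G q\<^esub> \<in> K_face G (q + 1) (q + 1) ` ?M"
    using K_face_one[of "q + 1" "q + 1"] by (intro image_eqI[OF _ one_in_moore_carrier]) simp
  ultimately show ?thesis
    unfolding moore_boundaries_def by blast
qed

section \<open>Homotopy groups\<close>

lemma homotopy_group_K_2: "homotopy_group (K_group G) (K_face G) 2 \<cong> G"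
proof -
  have "homotopy_group (K_group G) (K_face G) 2 \<cong> K_group G 2"
    using group.trivial_factor_iso[OF group_K_group, of 2]
    by (auto simp: homotopy_group_def moore_cycles_K moore_boundaries_K is_iso_def)
  also have "K_group G 2 \<cong> G"
  \<comment> \<open>The only index pair in degree \<open>2\<close> is \<open>(0, 1)\<close>, so
    evaluation there is the isomorphism; constant families give surjectivity.\<close>
  proof (rule is_isoI, rule isoI)
    show "(\<lambda>a. a (0, 1)) \<in> hom (K_group G 2) G"
      by (auto intro!: homI simp: K_groupD K_group_mult_apply)
    have idx: "u = 0 \<and> v = 1" if "u < v" "v < 2" for u v :: nat
      using that by linarith
    have "x \<in> (\<lambda>a. a (0, 1)) ` carrier (K_group G 2)" if "x \<in> carrier G" for x
      using that by (intro image_eqI[where x = "\<lambda>p\<in>pair_index 2. x"])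
        (auto simp: K_group_def pair_index_def)
    then show "bij_betw (\<lambda>a. a (0, 1)) (carrier (K_group G 2)) (carrier G)"
      by (auto simp: bij_betw_def inj_on_def K_groupD intro!: K_group_eqI[where A = G and q = 2] dest!: idx)
  qed
  finally show ?thesis .
qed

text \<open>The cycles already form the one-element group, and dividing by its trivial subgroup
  gives an isomorphic group.\<close>

lemma homotopy_group_K_trivial:
  assumes "q \<noteq> 2"
  shows "trivial_group (homotopy_group (K_group G) (K_face G) q)"
proof -
  interpret K: group "K_group G q" by (rule group_K_group)
  let ?H = "(K_group G q)\<lparr>carrier := {\<one>\<^bsub>K_group G q\<^esub>}\<rparr>"
  have H: "group ?H"
    using K.subgroup_imp_group K.triv_subgroup by blast
  have "?H Mod {\<one>\<^bsub>K_group G q\<^esub>} \<cong> ?H"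
    using group.trivial_factor_iso[OF H] by (auto simp: is_iso_def)
  moreover have "trivial_group ?H"
    using H by (simp add: trivial_group_def)
  moreover have "group (?H Mod {\<one>\<^bsub>K_group G q\<^esub>})"
    using normal.factorgroup_is_group[OF group.one_is_normal[OF H]] by simp
  ultimately show ?thesis
    using assms H isomorphic_group_triviality
    by (simp add: homotopy_group_def moore_cycles_K moore_boundaries_K) blast
qed

end

theorem theorem2p1:
  fixes A :: "('a, 'b) monoid_scheme"
  assumes "comm_group A"
  shows "eilenberg_maclane A 2 (K_group A) (K_face A) (K_degen A)"
  using comm_group.simplicial_group_K[OF assms] comm_group.homotopy_group_K_2[OF assms]
    comm_group.homotopy_group_K_trivial[OF assms]
  by (simp add: eilenberg_maclane_def)

end
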